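(* Let $\mathscr{C}$ be a semi-monoidal category. The category of Saavedra units in $\mathscr{C}$ is canonically isomorphic to the category $U(\mathscr{C})$ of LR units in $\mathscr{C}$ (the isomorphism being the correspondence $(I,\lambda,\rho)\leftrightarrow (I,\alpha)$ with $\alpha=\lambda_I=\rho_I$ on objects and the identity on underlying arrows $\psi:I\to J$). Hence the category of Saavedra units is contractible if it is nonempty.
   Context: A semi-monoidal category is a category $\mathscr{C}$ with a strictly associative functor $\mathscr{C}\times\mathscr{C}\to\mathscr{C}$, written as juxtaposition. The identity arrow of an object $X$ is also written $X$. An LR unit is a triple $(I,\lambda,\rho)$ where $I$ is an object and $\lambda_X: IX\to X$, $\rho_X: XI\to X$ are natural isomorphisms satisfying, for all $X,Y$: (1) $\lambda_I=\rho_I$; (2) $\lambda_{XY}=\lambda_X Y$; (3) $\rho_{XY}=X\rho_Y$; (4) $X\lambda_Y=\rho_X Y$. The category $U(\mathscr{C})$ has LR units as objects; an arrow $(I,\lambda,\rho)\to(I',\lambda',\rho')$ is an arrow $\psi:I\to I'$ of $\mathscr{C}$ such that $\lambda'_X\circ(\psi X)=\lambda_X$ and $\rho'_X\circ(X\psi)=\rho_X$ for every object $X$. An object $I$ is cancellable if the functors $X\mapsto IX$ and $X\mapsto XI$ are both fully faithful. A Saavedra unit is a pair $(I,\alpha)$ with $I$ cancellable and $\alpha: II\to I$ an isomorphism. For a Saavedra unit, $\alpha$ is automatically associative, i.e. $I\alpha=\alpha I$, and there are unique arrows $\lambda_X: IX\to X$, $\rho_X: XI\to X$ with $I\lambda_X=\alpha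 X$ and $\rho_XI=X\alpha$; these make $I$ an LR unit, and $(\lambda,\rho)\mapsto \alpha=\lambda_I=\rho_I$ is the inverse construction. For cancellable objects $I,J$, an arrow $\psi:I\to J$ is left tensor cancellable if for all $X,Y$ the map $\mathscr{C}(X,Y)\to\mathscr{C}(IX,JY)$, $f\mapsto\psi f$ (i.e. $\psi\otimes f$) is a bijection; right tensor cancellable is defined analogously with $f\mapsto f\psi$; tensor cancellable means both. A morphism of Saavedra units $(I,\alpha)\to(J,\beta)$ is a tensor cancellable arrow $\psi:I\to J$ which is a semi-monoid homomorphism: $\psi\circ\alpha=\beta\circ(\psi\psi)$ as arrows $II\to J$. A category is contractible if it is nonempty and there is exactly one arrow from any object to any other (i.e. it is equivalent to the terminal category). *)

theory Defs
  imports Main "HOL-Library.FuncSet"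
begin

section \<open>Categories and functors\<close>

text \<open>Objects and arrows are carried by sets, so a category may be empty; the values of the
  operations outside the carriers, and on non-composable pairs, are irrelevant.
  \<open>g \<cdot>\<^bsub>C\<^esub> f\<close> is ``\<open>g\<close> after \<open>f\<close>''.\<close>

record ('o, 'a) category_data =
  Obj :: "'o set"
  Arr :: "'a set"
  Dom :: "'a \<Rightarrow> 'o"
  Cod :: "'a \<Rightarrow> 'o"
  Ide :: "'o \<Rightarrow> 'a"
  Comp :: "'a \<Rightarrow> 'a \<Rightarrow> 'a"  (infixr "\<cdot>\<index>" 65)

definition Hom :: "('o, 'a, 'm) category_data_scheme \<Rightarrow> 'o \<Rightarrow> 'o \<Rightarrow> 'a set" where
  "Hom C X Y = {f \<in> Arr C. Dom C f = X \<and> Cod C f = Y}"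

locale category =
  fixes C :: "('o, 'a, 'm) category_data_scheme" (structure)
  assumes Dom_closed: "f \<in> Arr C \<Longrightarrow> Dom C f \<in> Obj C"
    and Cod_closed: "f \<in> Arr C \<Longrightarrow> Cod C f \<in> Obj C"
    and Ide_closed: "X \<in> Obj C \<Longrightarrow> Ide C X \<in> Hom C X X"
    and Comp_closed: "f \<in> Hom C X Y \<Longrightarrow> g \<in> Hom C Y Z \<Longrightarrow> g \<cdot> f \<in> Hom C X Z"
    and Comp_assoc: "f \<in> Hom C W X \<Longrightarrow> g \<in> Hom C X Y \<Longrightarrow> h \<in> Hom C Y Z \<Longrightarrow>
                       (h \<cdot> g) \<cdot> f = h \<cdot> (g \<cdot> f)"
    and Ide_left: "f \<in> Hom C X Y \<Longrightarrow> Ide C Y \<cdot> f = f"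
    and Ide_right: "f \<in> Hom C X Y \<Longrightarrow> f \<cdot> Ide C X = f"

definition iso_arrow :: "('o, 'a, 'm) category_data_scheme \<Rightarrow> 'a \<Rightarrow> bool" where
  "iso_arrow C f \<longleftrightarrow> f \<in> Arr C \<and>
     (\<exists>g \<in> Hom C (Cod C f) (Dom C f).
        g \<cdot>\<^bsub>C\<^esub> f = Ide C (Dom C f) \<and> f \<cdot>\<^bsub>C\<^esub> g = Ide C (Cod C f))"

definition contractible :: "('o, 'a, 'm) category_data_scheme \<Rightarrow> bool" where
  "contractible C \<longleftrightarrow> category C \<and> Obj C \<noteq> {} \<and>
     (\<forall>X \<in> Obj C. \<forall>Y \<in> Obj C. \<exists>!f. f \<in> Hom C X Y)"

record ('o, 'a, 'p, 'b) functor_data =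
  on_obj :: "'o \<Rightarrow> 'p"
  on_arr :: "'a \<Rightarrow> 'b"

locale cat_functor = S: category C + T: category D
  for C :: "('o, 'a, 'm) category_data_scheme"
    and D :: "('p, 'b, 'n) category_data_scheme"
    and F :: "('o, 'a, 'p, 'b) functor_data" +
  assumes on_obj_closed: "X \<in> Obj C \<Longrightarrow> on_obj F X \<in> Obj D"
    and on_arr_closed: "f \<in> Hom C X Y \<Longrightarrow> on_arr F f \<in> Hom D (on_obj F X) (on_obj F Y)"
    and on_arr_Ide: "X \<in> Obj C \<Longrightarrow> on_arr F (Ide C X) = Ide D (on_obj F X)"
    and on_arr_Comp: "f \<in> Hom C X Y \<Longrightarrow> g \<in> Hom C Y Z \<Longrightarrow>
                        on_arr F (g \<cdot>\<^bsub>C\<^esub> f) = on_arr F g \<cdot>\<^bsub>D\<^esub> on_arr F f"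

definition fully_faithful :: "('o, 'a, 'm) category_data_scheme \<Rightarrow>
    ('p, 'b, 'n) category_data_scheme \<Rightarrow> ('o, 'a, 'p, 'b) functor_data \<Rightarrow> bool" where
  "fully_faithful C D F \<longleftrightarrow> cat_functor C D F \<and>
     (\<forall>X \<in> Obj C. \<forall>Y \<in> Obj C.
        bij_betw (on_arr F) (Hom C X Y) (Hom D (on_obj F X) (on_obj F Y)))"

text \<open>An isomorphism of categories, given together with its inverse.\<close>

definition inverse_functors :: "('o, 'a, 'm) category_data_scheme \<Rightarrow>
    ('p, 'b, 'n) category_data_scheme \<Rightarrow>
    ('o, 'a, 'p, 'b) functor_data \<Rightarrow> ('p, 'b, 'o, 'a) functor_data \<Rightarrow> bool" where
  "inverse_functors C D F G \<longleftrightarrow> cat_functor C D F \<and> cat_functor D C G \<and>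
     (\<forall>X \<in> Obj C. on_obj G (on_obj F X) = X) \<and> (\<forall>f \<in> Arr C. on_arr G (on_arr F f) = f) \<and>
     (\<forall>Y \<in> Obj D. on_obj F (on_obj G Y) = Y) \<and> (\<forall>g \<in> Arr D. on_arr F (on_arr G g) = g)"

definition identity_functor :: "('o, 'a, 'o, 'a) functor_data" where
  "identity_functor = \<lparr>on_obj = (\<lambda>X. X), on_arr = (\<lambda>f. f)\<rparr>"

text \<open>Components are required to be \<open>undefined\<close> off the objects, so that two natural
  isomorphisms with the same components are equal as functions.\<close>

definition natural_iso :: "('o, 'a, 'm) category_data_scheme \<Rightarrow>
    ('p, 'b, 'n) category_data_scheme \<Rightarrow>
    ('o, 'a, 'p, 'b) functor_data \<Rightarrow> ('o, 'a, 'p, 'b) functor_data \<Rightarrow> ('o \<Rightarrow> 'b) \<Rightarrow> bool" where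
  "natural_iso C D F G t \<longleftrightarrow> cat_functor C D F \<and> cat_functor C D G \<and>
     t \<in> extensional (Obj C) \<and>
     (\<forall>X \<in> Obj C. t X \<in> Hom D (on_obj F X) (on_obj G X) \<and> iso_arrow D (t X)) \<and>
     (\<forall>X \<in> Obj C. \<forall>Y \<in> Obj C. \<forall>f \<in> Hom C X Y.
        t Y \<cdot>\<^bsub>D\<^esub> on_arr F f = on_arr G f \<cdot>\<^bsub>D\<^esub> t X)"

definition product_category :: "('o, 'a, 'm) category_data_scheme \<Rightarrow>
    ('p, 'b, 'n) category_data_scheme \<Rightarrow> ('o \<times> 'p, 'a \<times> 'b) category_data" where
  "product_category C D =
     \<lparr>Obj = Obj C \<times> Obj D,
      Arr = Arr C \<times> Arr D,
      Dom = map_prod (Dom C) (Dom D),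
      Cod = map_prod (Cod C) (Cod D),
      Ide = map_prod (Ide C) (Ide D),
      Comp = (\<lambda>g f. (fst g \<cdot>\<^bsub>C\<^esub> fst f, snd g \<cdot>\<^bsub>D\<^esub> snd f))\<rparr>"

text \<open>The category of objects of \<open>C\<close> with extra structure: \<open>u\<close> is the underlying object and
  \<open>P x y f\<close> says that the arrow \<open>f : u x \<rightarrow> u y\<close> of \<open>C\<close> respects the structures. An arrow is
  \<open>f\<close> tagged with its source and target \<open>x\<close>, \<open>y\<close>, since \<open>f\<close> alone does not determine them.\<close>

definition structured_category :: "('o, 'a, 'm) category_data_scheme \<Rightarrow> 's set \<Rightarrow> ('s \<Rightarrow> 'o) \<Rightarrow>
    ('s \<Rightarrow> 's \<Rightarrow> 'a \<Rightarrow> bool) \<Rightarrow> ('s, 's \<times> 'a \<times> 's) category_data" where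
  "structured_category C S u P =
     \<lparr>Obj = S,
      Arr = {(x, f, y). x \<in> S \<and> y \<in> S \<and> f \<in> Hom C (u x) (u y) \<and> P x y f},
      Dom = (\<lambda>(x, f, y). x),
      Cod = (\<lambda>(x, f, y). y),
      Ide = (\<lambda>x. (x, Ide C (u x), x)),
      Comp = (\<lambda>(_, g, z) (x, f, _). (x, g \<cdot>\<^bsub>C\<^esub> f, z))\<rparr>"


section \<open>Semi-monoidal categories\<close>

record ('o, 'a) semimonoidal_data = "('o, 'a) category_data" +
  tensor_obj :: "'o \<Rightarrow> 'o \<Rightarrow> 'o"  (infixl "\<otimes>\<index>" 70)
  tensor_arr :: "'a \<Rightarrow> 'a \<Rightarrow> 'a"  (infixl "\<odot>\<index>" 70)

definition tensor_functor :: "('o, 'a, 'm) semimonoidal_data_scheme \<Rightarrow>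
    ('o \<times> 'o, 'a \<times> 'a, 'o, 'a) functor_data" where
  "tensor_functor C =
     \<lparr>on_obj = (\<lambda>(X, Y). X \<otimes>\<^bsub>C\<^esub> Y), on_arr = (\<lambda>(f, g). f \<odot>\<^bsub>C\<^esub> g)\<rparr>"

locale semimonoidal_category = category C
  for C :: "('o, 'a, 'm) semimonoidal_data_scheme" (structure) +
  assumes tensor: "cat_functor (product_category C C) C (tensor_functor C)"
    and tensor_obj_assoc: "X \<in> Obj C \<Longrightarrow> Y \<in> Obj C \<Longrightarrow> Z \<in> Obj C \<Longrightarrow>
                             (X \<otimes> Y) \<otimes> Z = X \<otimes> (Y \<otimes> Z)"
    and tensor_arr_assoc: "f \<in> Arr C \<Longrightarrow> g \<in> Arr C \<Longrightarrow> h \<in> Arr C \<Longrightarrow>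
                             (f \<odot> g) \<odot> h = f \<odot> (g \<odot> h)"

definition left_tensor :: "('o, 'a, 'm) semimonoidal_data_scheme \<Rightarrow> 'o \<Rightarrow>
    ('o, 'a, 'o, 'a) functor_data" where
  "left_tensor C I = \<lparr>on_obj = (\<lambda>X. I \<otimes>\<^bsub>C\<^esub> X), on_arr = (\<lambda>f. Ide C I \<odot>\<^bsub>C\<^esub> f)\<rparr>"

definition right_tensor :: "('o, 'a, 'm) semimonoidal_data_scheme \<Rightarrow> 'o \<Rightarrow>
    ('o, 'a, 'o, 'a) functor_data" where
  "right_tensor C I = \<lparr>on_obj = (\<lambda>X. X \<otimes>\<^bsub>C\<^esub> I), on_arr = (\<lambda>f. f \<odot>\<^bsub>C\<^esub> Ide C I)\<rparr>"


section \<open>LR units\<close>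

type_synonym ('o, 'a) lr_triple = "'o \<times> ('o \<Rightarrow> 'a) \<times> ('o \<Rightarrow> 'a)"

definition LR_units :: "('o, 'a, 'm) semimonoidal_data_scheme \<Rightarrow> ('o, 'a) lr_triple set" where
  "LR_units C = {(I, l, r). I \<in> Obj C \<and>
     natural_iso C C (left_tensor C I) identity_functor l \<and>
     natural_iso C C (right_tensor C I) identity_functor r \<and>
     l I = r I \<and>
     (\<forall>X \<in> Obj C. \<forall>Y \<in> Obj C.
        l (X \<otimes>\<^bsub>C\<^esub> Y) = l X \<odot>\<^bsub>C\<^esub> Ide C Y \<and>
        r (X \<otimes>\<^bsub>C\<^esub> Y) = Ide C X \<odot>\<^bsub>C\<^esub> r Y \<and>
        Ide C X \<odot>\<^bsub>C\<^esub> l Y = r X \<odot>\<^bsub>C\<^esub> Ide C Y)}"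

definition LR_compatible :: "('o, 'a, 'm) semimonoidal_data_scheme \<Rightarrow>
    ('o, 'a) lr_triple \<Rightarrow> ('o, 'a) lr_triple \<Rightarrow> 'a \<Rightarrow> bool" where
  "LR_compatible C = (\<lambda>(I, l, r) (I', l', r') p. \<forall>X \<in> Obj C.
     l' X \<cdot>\<^bsub>C\<^esub> (p \<odot>\<^bsub>C\<^esub> Ide C X) = l X \<and> r' X \<cdot>\<^bsub>C\<^esub> (Ide C X \<odot>\<^bsub>C\<^esub> p) = r X)"

definition LR_category :: "('o, 'a, 'm) semimonoidal_data_scheme \<Rightarrow>
    (('o, 'a) lr_triple, ('o, 'a) lr_triple \<times> 'a \<times> ('o, 'a) lr_triple) category_data" where
  "LR_category C = structured_category C (LR_units C) fst (LR_compatible C)"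


section \<open>Saavedra units\<close>

definition cancellable :: "('o, 'a, 'm) semimonoidal_data_scheme \<Rightarrow> 'o \<Rightarrow> bool" where
  "cancellable C I \<longleftrightarrow> I \<in> Obj C \<and>
     fully_faithful C C (left_tensor C I) \<and> fully_faithful C C (right_tensor C I)"

definition saavedra_units :: "('o, 'a, 'm) semimonoidal_data_scheme \<Rightarrow> ('o \<times> 'a) set" where
  "saavedra_units C =
     {(I, a). cancellable C I \<and> a \<in> Hom C (I \<otimes>\<^bsub>C\<^esub> I) I \<and> iso_arrow C a}"

definition left_tensor_cancellable ::
    "('o, 'a, 'm) semimonoidal_data_scheme \<Rightarrow> 'o \<Rightarrow> 'o \<Rightarrow> 'a \<Rightarrow> bool" where
  "left_tensor_cancellable C I J p \<longleftrightarrow> p \<in> Hom C I J \<and>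
     (\<forall>X \<in> Obj C. \<forall>Y \<in> Obj C.
        bij_betw (\<lambda>f. p \<odot>\<^bsub>C\<^esub> f) (Hom C X Y) (Hom C (I \<otimes>\<^bsub>C\<^esub> X) (J \<otimes>\<^bsub>C\<^esub> Y)))"

definition right_tensor_cancellable ::
    "('o, 'a, 'm) semimonoidal_data_scheme \<Rightarrow> 'o \<Rightarrow> 'o \<Rightarrow> 'a \<Rightarrow> bool" where
  "right_tensor_cancellable C I J p \<longleftrightarrow> p \<in> Hom C I J \<and>
     (\<forall>X \<in> Obj C. \<forall>Y \<in> Obj C.
        bij_betw (\<lambda>f. f \<odot>\<^bsub>C\<^esub> p) (Hom C X Y) (Hom C (X \<otimes>\<^bsub>C\<^esub> I) (Y \<otimes>\<^bsub>C\<^esub> J)))"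

definition tensor_cancellable ::
    "('o, 'a, 'm) semimonoidal_data_scheme \<Rightarrow> 'o \<Rightarrow> 'o \<Rightarrow> 'a \<Rightarrow> bool" where
  "tensor_cancellable C I J p \<longleftrightarrow>
     left_tensor_cancellable C I J p \<and> right_tensor_cancellable C I J p"

definition saavedra_morphism :: "('o, 'a, 'm) semimonoidal_data_scheme \<Rightarrow>
    'o \<times> 'a \<Rightarrow> 'o \<times> 'a \<Rightarrow> 'a \<Rightarrow> bool" where
  "saavedra_morphism C = (\<lambda>(I, a) (J, b) p.
     tensor_cancellable C I J p \<and> p \<cdot>\<^bsub>C\<^esub> a = b \<cdot>\<^bsub>C\<^esub> (p \<odot>\<^bsub>C\<^esub> p))"

definition saavedra_category :: "('o, 'a, 'm) semimonoidal_data_scheme \<Rightarrow>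
    ('o \<times> 'a, ('o \<times> 'a) \<times> 'a \<times> ('o \<times> 'a)) category_data" where
  "saavedra_category C = structured_category C (saavedra_units C) fst (saavedra_morphism C)"


section \<open>The comparison functors\<close>

definition LR_to_saavedra_obj :: "('o, 'a) lr_triple \<Rightarrow> 'o \<times> 'a" where
  "LR_to_saavedra_obj = (\<lambda>(I, l, r). (I, l I))"

definition LR_to_saavedra :: "(('o, 'a) lr_triple, ('o, 'a) lr_triple \<times> 'a \<times> ('o, 'a) lr_triple,
    'o \<times> 'a, ('o \<times> 'a) \<times> 'a \<times> ('o \<times> 'a)) functor_data" where
  "LR_to_saavedra =
     \<lparr>on_obj = LR_to_saavedra_obj,
      on_arr = (\<lambda>(x, p, y). (LR_to_saavedra_obj x, p, LR_to_saavedra_obj y))\<rparr>"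

definition saavedra_left :: "('o, 'a, 'm) semimonoidal_data_scheme \<Rightarrow> 'o \<times> 'a \<Rightarrow> 'o \<Rightarrow> 'a" where
  "saavedra_left C = (\<lambda>(I, a). \<lambda>X \<in> Obj C.
     THE f. f \<in> Hom C (I \<otimes>\<^bsub>C\<^esub> X) X \<and> Ide C I \<odot>\<^bsub>C\<^esub> f = a \<odot>\<^bsub>C\<^esub> Ide C X)"

definition saavedra_right :: "('o, 'a, 'm) semimonoidal_data_scheme \<Rightarrow> 'o \<times> 'a \<Rightarrow> 'o \<Rightarrow> 'a" where
  "saavedra_right C = (\<lambda>(I, a). \<lambda>X \<in> Obj C.
     THE f. f \<in> Hom C (X \<otimes>\<^bsub>C\<^esub> I) X \<and> f \<odot>\<^bsub>C\<^esub> Ide C I = Ide C X \<odot>\<^bsub>C\<^esub> a)"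

definition saavedra_to_LR_obj :: "('o, 'a, 'm) semimonoidal_data_scheme \<Rightarrow>
    'o \<times> 'a \<Rightarrow> ('o, 'a) lr_triple" where
  "saavedra_to_LR_obj C s = (fst s, saavedra_left C s, saavedra_right C s)"

definition saavedra_to_LR :: "('o, 'a, 'm) semimonoidal_data_scheme \<Rightarrow>
    ('o \<times> 'a, ('o \<times> 'a) \<times> 'a \<times> ('o \<times> 'a),
     ('o, 'a) lr_triple, ('o, 'a) lr_triple \<times> 'a \<times> ('o, 'a) lr_triple) functor_data" where
  "saavedra_to_LR C =
     \<lparr>on_obj = saavedra_to_LR_obj C,
      on_arr = (\<lambda>(s, p, t). (saavedra_to_LR_obj C s, p, saavedra_to_LR_obj C t))\<rparr>"

text \<open>The definite descriptions in \<^const>\<open>saavedra_left\<close> and \<^const>\<open>saavedra_right\<close> are proper.\<close>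

lemma bij_betw_ex1_preimage:
  assumes "bij_betw h A B" and "b \<in> B"
  shows "\<exists>!x. x \<in> A \<and> h x = b"
  using assms by (auto simp: bij_betw_def inj_on_def)

context semimonoidal_category
begin

lemma tensor_obj_closed: "X \<in> Obj C \<Longrightarrow> Y \<in> Obj C \<Longrightarrow> X \<otimes> Y \<in> Obj C"
  using cat_functor.on_obj_closed[OF tensor, of "(X, Y)"]
  by (simp add: product_category_def tensor_functor_def)

lemma tensor_arr_closed:
  "f \<in> Hom C X Y \<Longrightarrow> g \<in> Hom C X' Y' \<Longrightarrow> f \<odot> g \<in> Hom C (X \<otimes> X') (Y \<otimes> Y')"
  using cat_functor.on_arr_closed[OF tensor, of "(f, g)" "(X, X')" "(Y, Y')"]
  by (simp add: product_category_def tensor_functor_def Hom_def)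

lemma saavedra_left_ex1:
  assumes "(I, a) \<in> saavedra_units C" and X: "X \<in> Obj C"
  shows "\<exists>!f. f \<in> Hom C (I \<otimes> X) X \<and> Ide C I \<odot> f = a \<odot> Ide C X"
proof -
  have I: "I \<in> Obj C" and a: "a \<in> Hom C (I \<otimes> I) I" and ff: "fully_faithful C C (left_tensor C I)"
    using assms(1) by (auto simp: saavedra_units_def cancellable_def)
  have "bij_betw (\<lambda>f. Ide C I \<odot> f) (Hom C (I \<otimes> X) X) (Hom C (I \<otimes> (I \<otimes> X)) (I \<otimes> X))"
    using ff tensor_obj_closed[OF I X] X by (simp add: fully_faithful_def left_tensor_def)
  moreover have "a \<odot> Ide C X \<in> Hom C (I \<otimes> (I \<otimes> X)) (I \<otimes> X)"
    using tensor_arr_closed[OF a Ide_closed[OF X]] by (simp add: tensor_obj_assoc I X)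
  ultimately show ?thesis
    by (rule bij_betw_ex1_preimage)
qed

lemma saavedra_right_ex1:
  assumes "(I, a) \<in> saavedra_units C" and X: "X \<in> Obj C"
  shows "\<exists>!f. f \<in> Hom C (X \<otimes> I) X \<and> f \<odot> Ide C I = Ide C X \<odot> a"
proof -
  have I: "I \<in> Obj C" and a: "a \<in> Hom C (I \<otimes> I) I" and ff: "fully_faithful C C (right_tensor C I)"
    using assms(1) by (auto simp: saavedra_units_def cancellable_def)
  have "bij_betw (\<lambda>f. f \<odot> Ide C I) (Hom C (X \<otimes> I) X) (Hom C ((X \<otimes> I) \<otimes> I) (X \<otimes> I))"
    using ff tensor_obj_closed[OF X I] X by (simp add: fully_faithful_def right_tensor_def)
  moreover have "Ide C X \<odot> a \<in> Hom C ((X \<otimes> I) \<otimes> I) (X \<otimes> I)"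
    using tensor_arr_closed[OF Ide_closed[OF X] a] by (simp add: tensor_obj_assoc I X)
  ultimately show ?thesis
    by (rule bij_betw_ex1_preimage)
qed

end

end

theory Submission
  imports Defs
begin

text \<open>For a Saavedra unit, naturality of \<open>\<lambda>\<close> at \<open>\<lambda>\<^sub>X\<close> gives \<open>\<lambda>\<^sub>I\<^sub>X = I \<lambda>\<^sub>X = \<alpha> X\<close>, while \<open>\<lambda>\<^sub>I\<^sub>X = \<lambda>\<^sub>I X\<close>;
  taking \<open>X = I\<close> and cancelling gives \<open>\<lambda>\<^sub>I = \<alpha>\<close>, and dually \<open>\<rho>\<^sub>I = \<alpha>\<close>. Both \<open>\<rho>\<^sub>X I Y\<close> and \<open>X I \<lambda>\<^sub>Y\<close> equal \<open>X \<alpha> Y\<close>, so the two ways of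
  factoring \<open>\<rho>\<^sub>X \<otimes> \<lambda>\<^sub>Y\<close> show \<open>X \<lambda>\<^sub>Y = \<rho>\<^sub>X Y\<close>. For an arrow \<open>\<psi>\<close> between units, compatibility with
  the LR structure amounts to \<open>\<lambda>'\<^sub>Y \<circ> (\<psi> f) = f \<circ> \<lambda>\<^sub>X\<close> (and its dual), which makes \<open>f \<mapsto> \<psi> f\<close> bijective
  and, at \<open>f = \<psi>\<close>, is the homomorphism law; conversely, for a homomorphism \<open>\<psi>\<close> the arrows \<open>\<lambda>\<^sub>X\<close> and
  \<open>\<lambda>'\<^sub>X \<circ> \<psi> X\<close> have the same image under \<open>\<psi> \<otimes> -\<close>. Finally \<open>\<psi> \<circ> \<rho>'\<^sub>I = \<lambda>\<^sub>I\<^sub>'\<close> determines the only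
  arrow \<open>I \<rightarrow> I'\<close> of LR units.\<close>

section \<open>Isomorphisms and fully faithful functors\<close>

context category
begin

lemma Hom_Obj: "f \<in> Hom C X Y \<Longrightarrow> X \<in> Obj C \<and> Y \<in> Obj C"
  using Dom_closed Cod_closed by (auto simp: Hom_def)

lemma iso_arrowE:
  assumes "iso_arrow C f" "f \<in> Hom C X Y"
  obtains g where "g \<in> Hom C Y X" "g \<cdot> f = Ide C X" "f \<cdot> g = Ide C Y"
  using assms by (auto simp: iso_arrow_def Hom_def)

lemma iso_arrowI:
  assumes "f \<in> Hom C X Y" "g \<in> Hom C Y X" "g \<cdot> f = Ide C X" "f \<cdot> g = Ide C Y"
  shows "iso_arrow C f"
  using assms by (auto simp: iso_arrow_def Hom_def)

lemma iso_monic: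
  assumes "iso_arrow C f" "f \<in> Hom C Y Z" "g \<in> Hom C X Y" "h \<in> Hom C X Y" "f \<cdot> g = f \<cdot> h"
  shows "g = h"
proof -
  obtain k where k: "k \<in> Hom C Z Y" "k \<cdot> f = Ide C Y" "f \<cdot> k = Ide C Z"
    by (rule iso_arrowE[OF assms(1,2)])
  have "g = k \<cdot> (f \<cdot> g)"
    unfolding Comp_assoc[OF assms(3,2) k(1), symmetric] k(2) by (rule Ide_left[OF assms(3), symmetric])
  also have "\<dots> = h"
    unfolding assms(5) Comp_assoc[OF assms(4,2) k(1), symmetric] k(2) by (rule Ide_left[OF assms(4)])
  finally show ?thesis .
qed

lemma iso_epic:
  assumes "iso_arrow C f" "f \<in> Hom C X Y" "g \<in> Hom C Y Z" "h \<in> Hom C Y Z" "g \<cdot> f = h \<cdot> f"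
  shows "g = h"
proof -
  obtain k where k: "k \<in> Hom C Y X" "k \<cdot> f = Ide C X" "f \<cdot> k = Ide C Y"
    by (rule iso_arrowE[OF assms(1,2)])
  have "g = (g \<cdot> f) \<cdot> k"
    unfolding Comp_assoc[OF k(1) assms(2,3)] k(3) by (rule Ide_right[OF assms(3), symmetric])
  also have "\<dots> = h"
    unfolding assms(5) Comp_assoc[OF k(1) assms(2,4)] k(3) by (rule Ide_right[OF assms(4)])
  finally show ?thesis .
qed

text \<open>The relation \<open>b \<cdot> h f = f \<cdot> a\<close> forces \<open>h\<close> to be
  conjugation by the isomorphisms \<open>a\<close> and \<open>b\<close>. It covers both a functor
  isomorphic to the identity and the map that tensors with a compatible arrow of units.\<close>

lemma bij_betw_Hom_conjugation:
  assumes a: "a \<in> Hom C X' X" "iso_arrow C a" and b: "b \<in> Hom C Y' Y" "iso_arrow C b"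
    and h: "\<And>f. f \<in> Hom C X Y \<Longrightarrow> h f \<in> Hom C X' Y'"
    and conj: "\<And>f. f \<in> Hom C X Y \<Longrightarrow> b \<cdot> h f = f \<cdot> a"
  shows "bij_betw h (Hom C X Y) (Hom C X' Y')"
proof -
  obtain a' where a': "a' \<in> Hom C X X'" "a' \<cdot> a = Ide C X'" "a \<cdot> a' = Ide C X"
    by (rule iso_arrowE[OF a(2,1)])
  have "inj_on h (Hom C X Y)"
  proof (rule inj_onI)
    fix f g assume "f \<in> Hom C X Y" "g \<in> Hom C X Y" "h f = h g"
    then show "f = g"
      using iso_epic[OF a(2,1), of f Y g] conj[of f] conj[of g] by simp
  qed
  moreover have "\<exists>f \<in> Hom C X Y. h f = g" if g: "g \<in> Hom C X' Y'" for g
  proof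
    \<comment> \<open>The relation \<open>b \<cdot> g = f \<cdot> a\<close> solved for
      \<open>f\<close>.\<close>
    let ?f = "(b \<cdot> g) \<cdot> a'"
    have bg: "b \<cdot> g \<in> Hom C X' Y"
      using g b(1) by (rule Comp_closed)
    show f: "?f \<in> Hom C X Y"
      using a'(1) bg by (rule Comp_closed)
    have "b \<cdot> h ?f = b \<cdot> g"
      using conj[OF f] Comp_assoc[OF a(1) a'(1) bg] Ide_right[OF bg] a'(2) by simp
    then show "h ?f = g"
      using iso_monic[OF b(2,1) h[OF f] g] by simp
  qed
  ultimately show ?thesis
    unfolding bij_betw_def using h by blast
qed

lemma identity_functor: "cat_functor C C identity_functor"
  by unfold_locales (auto simp: identity_functor_def)

text \<open>The naturality square of \<open>t\<close> is the conjugation relation with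
  \<open>a = t X\<close> and \<open>b = t Y\<close>.\<close>

lemma natural_iso_identity_imp_fully_faithful:
  assumes "natural_iso C C F identity_functor t"
  shows "fully_faithful C C F"
proof -
  interpret F: cat_functor C C F
    using assms by (simp add: natural_iso_def)
  have "bij_betw (on_arr F) (Hom C X Y) (Hom C (on_obj F X) (on_obj F Y))"
    if "X \<in> Obj C" "Y \<in> Obj C" for X Y
    using assms that F.on_arr_closed
    by (intro bij_betw_Hom_conjugation[of "t X" _ _ "t Y"])
       (auto simp: natural_iso_def identity_functor_def)
  then show ?thesis
    using F.cat_functor_axioms by (simp add: fully_faithful_def)
qed

end

lemma fully_faithful_imp_eq:
  assumes "fully_faithful C D F" "f \<in> Hom C X Y" "g \<in> Hom C X Y" "on_arr F f = on_arr F g"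
  shows "f = g"
proof -
  interpret F: cat_functor C D F
    using assms(1) by (simp add: fully_faithful_def)
  show ?thesis
    using assms F.S.Hom_Obj[OF assms(2)]
    unfolding fully_faithful_def bij_betw_def inj_on_def by blast
qed

text \<open>Fullness lifts the inverse to \<open>C\<close>; faithfulness lifts the two equations
  that make it an inverse.\<close>

lemma fully_faithful_reflects_iso:
  assumes ff: "fully_faithful C D F" and f: "f \<in> Hom C X Y" and iso: "iso_arrow D (on_arr F f)"
  shows "iso_arrow C f"
proof -
  interpret F: cat_functor C D F
    using ff by (simp add: fully_faithful_def)
  note XY = F.S.Hom_Obj[OF f]
  obtain k where k: "k \<in> Hom D (on_obj F Y) (on_obj F X)"
    "k \<cdot>\<^bsub>D\<^esub> on_arr F f = Ide D (on_obj F X)" "on_arr F f \<cdot>\<^bsub>D\<^esub> k = Ide D (on_obj F Y)"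
    by (rule F.T.iso_arrowE[OF iso F.on_arr_closed[OF f]])
  have "k \<in> on_arr F ` Hom C Y X"
    using ff XY k(1) by (simp add: fully_faithful_def bij_betw_def)
  then obtain g where g: "g \<in> Hom C Y X" "on_arr F g = k"
    by blast
  have "g \<cdot>\<^bsub>C\<^esub> f = Ide C X"
    by (rule fully_faithful_imp_eq[OF ff F.S.Comp_closed[OF f g(1)]])
       (use XY f g k in \<open>auto simp: F.S.Ide_closed F.on_arr_Ide F.on_arr_Comp\<close>)
  moreover have "f \<cdot>\<^bsub>C\<^esub> g = Ide C Y"
    by (rule fully_faithful_imp_eq[OF ff F.S.Comp_closed[OF g(1) f]])
       (use XY f g k in \<open>auto simp: F.S.Ide_closed F.on_arr_Ide F.on_arr_Comp\<close>)
  ultimately show ?thesis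
    using F.S.iso_arrowI[OF f g(1)] by simp
qed


section \<open>Categories of structured objects\<close>

lemma Hom_structured_category:
  "f \<in> Hom (structured_category C S u P) x y \<longleftrightarrow>
     x \<in> S \<and> y \<in> S \<and> (\<exists>p. f = (x, p, y) \<and> p \<in> Hom C (u x) (u y) \<and> P x y p)"
  \<comment> \<open>The instance of \<open>Hom_def\<close> opens only the outer hom-set and leaves
    \<open>Hom C\<close> folded.\<close>
  unfolding Hom_def[of "structured_category C S u P"] by (auto simp: structured_category_def)

lemma structured_category_simps:
  "Obj (structured_category C S u P) = S"
  "Ide (structured_category C S u P) x = (x, Ide C (u x), x)"
  "(y', g, z) \<cdot>\<^bsub>structured_category C S u P\<^esub> (x, f, y) = (x, g \<cdot>\<^bsub>C\<^esub> f, z)"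
  by (simp_all add: structured_category_def)

text \<open>Composition acts on the underlying arrows, so the laws are inherited from
  \<open>C\<close>; what remains is that \<open>P\<close> contains the identities and is closed
  under composition.\<close>

lemma (in category) category_structured_category:
  assumes u: "\<And>x. x \<in> S \<Longrightarrow> u x \<in> Obj C"
    and ide: "\<And>x. x \<in> S \<Longrightarrow> P x x (Ide C (u x))"
    and comp: "\<And>x y z f g. \<lbrakk>x \<in> S; y \<in> S; z \<in> S; f \<in> Hom C (u x) (u y); g \<in> Hom C (u y) (u z);
                 P x y f; P y z g\<rbrakk> \<Longrightarrow> P x z (g \<cdot> f)"
  shows "category (structured_category C S u P)"
proof
  fix f assume "f \<in> Arr (structured_category C S u P)"
  then show "Dom (structured_category C S u P) f \<in> Obj (structured_category C S u P)"
    and "Cod (structured_category C S u P) f \<in> Obj (structured_category C S u P)"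
    by (auto simp: structured_category_def)
next
  fix x assume "x \<in> Obj (structured_category C S u P)"
  then show "Ide (structured_category C S u P) x \<in> Hom (structured_category C S u P) x x"
    using u ide Ide_closed by (simp add: Hom_structured_category structured_category_simps)
next
  fix f g x y z
  assume "f \<in> Hom (structured_category C S u P) x y" "g \<in> Hom (structured_category C S u P) y z"
  then obtain p q where "f = (x, p, y)" "g = (y, q, z)" "x \<in> S" "y \<in> S" "z \<in> S"
    and p: "p \<in> Hom C (u x) (u y)" "P x y p" and q: "q \<in> Hom C (u y) (u z)" "P y z q"
    unfolding Hom_structured_category by blast
  then show "g \<cdot>\<^bsub>structured_category C S u P\<^esub> f \<in> Hom (structured_category C S u P) x z"
    using comp[OF _ _ _ p(1) q(1) p(2) q(2)] Comp_closed[OF p(1) q(1)]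
    by (simp add: Hom_structured_category structured_category_simps)
next
  fix f g h w x y z
  assume "f \<in> Hom (structured_category C S u P) w x" "g \<in> Hom (structured_category C S u P) x y"
    "h \<in> Hom (structured_category C S u P) y z"
  then obtain p q t where "f = (w, p, x)" "g = (x, q, y)" "h = (y, t, z)"
    and pqt: "p \<in> Hom C (u w) (u x)" "q \<in> Hom C (u x) (u y)" "t \<in> Hom C (u y) (u z)"
    unfolding Hom_structured_category by blast
  then show "(h \<cdot>\<^bsub>structured_category C S u P\<^esub> g) \<cdot>\<^bsub>structured_category C S u P\<^esub> f =
      h \<cdot>\<^bsub>structured_category C S u P\<^esub> (g \<cdot>\<^bsub>structured_category C S u P\<^esub> f)"
    using Comp_assoc[OF pqt] by (simp add: structured_category_simps)
next
  fix f x y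
  assume "f \<in> Hom (structured_category C S u P) x y"
  then obtain p where f: "f = (x, p, y)" "p \<in> Hom C (u x) (u y)"
    unfolding Hom_structured_category by blast
  show "Ide (structured_category C S u P) y \<cdot>\<^bsub>structured_category C S u P\<^esub> f = f"
    and "f \<cdot>\<^bsub>structured_category C S u P\<^esub> Ide (structured_category C S u P) x = f"
    using f Ide_left[OF f(2)] Ide_right[OF f(2)] by (simp_all add: structured_category_simps)
qed

text \<open>As \<open>F\<close> preserves underlying objects, an arrow can keep its underlying arrow
  and merely be retagged. Both comparison functors have this shape.\<close>

lemma cat_functor_structured_category:
  assumes "category (structured_category C S u P)" "category (structured_category C T v Q)"
    and F: "\<And>x. x \<in> S \<Longrightarrow> F x \<in> T" "\<And>x. x \<in> S \<Longrightarrow> v (F x) = u x"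
    and PQ: "\<And>x y p. \<lbrakk>x \<in> S; y \<in> S; p \<in> Hom C (u x) (u y); P x y p\<rbrakk> \<Longrightarrow> Q (F x) (F y) p"
  shows "cat_functor (structured_category C S u P) (structured_category C T v Q)
           \<lparr>on_obj = F, on_arr = (\<lambda>(x, p, y). (F x, p, F y))\<rparr>"
proof -
  interpret S: category "structured_category C S u P" by fact
  interpret T: category "structured_category C T v Q" by fact
  show ?thesis
    by unfold_locales (use F PQ in \<open>auto simp: Hom_structured_category structured_category_simps\<close>)
qed


section \<open>Tensor calculus\<close>

context semimonoidal_category
begin

lemma interchange:
  assumes "f \<in> Hom C X Y" "g \<in> Hom C Y Z" "f' \<in> Hom C X' Y'" "g' \<in> Hom C Y' Z'"
  shows "(g \<cdot> f) \<odot> (g' \<cdot> f') = (g \<odot> g') \<cdot> (f \<odot> f')"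
  using cat_functor.on_arr_Comp[OF tensor, of "(f, f')" "(X, X')" "(Y, Y')" "(g, g')" "(Z, Z')"] assms
  by (simp add: product_category_def tensor_functor_def Hom_def)

lemma Ide_tensor: "X \<in> Obj C \<Longrightarrow> Y \<in> Obj C \<Longrightarrow> Ide C X \<odot> Ide C Y = Ide C (X \<otimes> Y)"
  using cat_functor.on_arr_Ide[OF tensor, of "(X, Y)"]
  by (simp add: product_category_def tensor_functor_def)

lemma whisker_left:
  assumes "W \<in> Obj C" "f \<in> Hom C X Y" "g \<in> Hom C Y Z"
  shows "Ide C W \<odot> (g \<cdot> f) = (Ide C W \<odot> g) \<cdot> (Ide C W \<odot> f)"
  using interchange[OF Ide_closed[OF assms(1)] Ide_closed[OF assms(1)] assms(2,3)]
    Ide_left[OF Ide_closed[OF assms(1)]] by simp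

lemma whisker_right:
  assumes "W \<in> Obj C" "f \<in> Hom C X Y" "g \<in> Hom C Y Z"
  shows "(g \<cdot> f) \<odot> Ide C W = (g \<odot> Ide C W) \<cdot> (f \<odot> Ide C W)"
  using interchange[OF assms(2,3) Ide_closed[OF assms(1)] Ide_closed[OF assms(1)]]
    Ide_left[OF Ide_closed[OF assms(1)]] by simp

text \<open>Together with \<open>tensor_eq_left_right\<close> this lets arrows in different tensor
  factors slide past each other, which is how most equations below are obtained.\<close>

lemma tensor_eq_right_left:
  assumes "f \<in> Hom C X Y" "g \<in> Hom C X' Y'"
  shows "f \<odot> g = (f \<odot> Ide C Y') \<cdot> (Ide C X \<odot> g)"
  using interchange[OF Ide_closed assms(1,2) Ide_closed] Hom_Obj[OF assms(1)]
    Hom_Obj[OF assms(2)] Ide_left[OF assms(2)] Ide_right[OF assms(1)] by simp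

lemma tensor_eq_left_right:
  assumes "f \<in> Hom C X Y" "g \<in> Hom C X' Y'"
  shows "f \<odot> g = (Ide C Y \<odot> g) \<cdot> (f \<odot> Ide C X')"
  using interchange[OF assms(1) Ide_closed Ide_closed assms(2)] Hom_Obj[OF assms(1)]
    Hom_Obj[OF assms(2)] Ide_left[OF assms(1)] Ide_right[OF assms(2)] by simp

lemma Hom_arr: "f \<in> Hom C X Y \<Longrightarrow> f \<in> Arr C"
  by (simp add: Hom_def)

lemma Ide_arr: "X \<in> Obj C \<Longrightarrow> Ide C X \<in> Arr C"
  using Ide_closed Hom_arr by blast

lemma left_tensor_functor: "I \<in> Obj C \<Longrightarrow> cat_functor C C (left_tensor C I)"
  by unfold_locales
     (auto simp: left_tensor_def tensor_obj_closed tensor_arr_closed Ide_closed Ide_tensor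
        whisker_left)

lemma right_tensor_functor: "I \<in> Obj C \<Longrightarrow> cat_functor C C (right_tensor C I)"
  by unfold_locales
     (auto simp: right_tensor_def tensor_obj_closed tensor_arr_closed Ide_closed Ide_tensor
        whisker_right)

lemma iso_tensor:
  assumes f: "iso_arrow C f" "f \<in> Hom C X Y" and g: "iso_arrow C g" "g \<in> Hom C X' Y'"
  shows "iso_arrow C (f \<odot> g)"
proof -
  obtain f' where f': "f' \<in> Hom C Y X" "f' \<cdot> f = Ide C X" "f \<cdot> f' = Ide C Y"
    by (rule iso_arrowE[OF f])
  obtain g' where g': "g' \<in> Hom C Y' X'" "g' \<cdot> g = Ide C X'" "g \<cdot> g' = Ide C Y'"
    by (rule iso_arrowE[OF g])
  show ?thesis
    by (rule iso_arrowI[OF tensor_arr_closed[OF f(2) g(2)] tensor_arr_closed[OF f'(1) g'(1)]])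
       (use f' g' Hom_Obj[OF f(2)] Hom_Obj[OF g(2)] in
         \<open>simp_all add: interchange[symmetric, OF f(2) f'(1) g(2) g'(1)]
            interchange[symmetric, OF f'(1) f(2) g'(1) g(2)] Ide_tensor\<close>)
qed

lemma iso_Ide: "X \<in> Obj C \<Longrightarrow> iso_arrow C (Ide C X)"
  using iso_arrowI Ide_closed Ide_left by metis

end


section \<open>From LR units to Saavedra units\<close>

locale lr_unit = semimonoidal_category C
  for C :: "('o, 'a, 'm) semimonoidal_data_scheme" (structure) +
  fixes I l r
  assumes LR: "(I, l, r) \<in> LR_units C"
begin

lemma I_obj: "I \<in> Obj C"
  using LR by (simp add: LR_units_def)

lemma l_Hom: "X \<in> Obj C \<Longrightarrow> l X \<in> Hom C (I \<otimes> X) X"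
  and l_iso: "X \<in> Obj C \<Longrightarrow> iso_arrow C (l X)"
  and l_ext: "l \<in> extensional (Obj C)"
  and r_Hom: "X \<in> Obj C \<Longrightarrow> r X \<in> Hom C (X \<otimes> I) X"
  and r_iso: "X \<in> Obj C \<Longrightarrow> iso_arrow C (r X)"
  and r_ext: "r \<in> extensional (Obj C)"
  using LR by (auto simp: LR_units_def natural_iso_def left_tensor_def right_tensor_def
                 identity_functor_def)

lemma l_natural: "f \<in> Hom C X Y \<Longrightarrow> l Y \<cdot> (Ide C I \<odot> f) = f \<cdot> l X"
  and r_natural: "f \<in> Hom C X Y \<Longrightarrow> r Y \<cdot> (f \<odot> Ide C I) = f \<cdot> r X"
  using LR Hom_Obj[of f X Y]
  by (auto simp: LR_units_def natural_iso_def left_tensor_def right_tensor_def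
        identity_functor_def)

lemma l_I_eq_r_I: "l I = r I"
  using LR by (simp add: LR_units_def)

lemma l_tensor: "X \<in> Obj C \<Longrightarrow> Y \<in> Obj C \<Longrightarrow> l (X \<otimes> Y) = l X \<odot> Ide C Y"
  and r_tensor: "X \<in> Obj C \<Longrightarrow> Y \<in> Obj C \<Longrightarrow> r (X \<otimes> Y) = Ide C X \<odot> r Y"
  and l_r_swap: "X \<in> Obj C \<Longrightarrow> Y \<in> Obj C \<Longrightarrow> Ide C X \<odot> l Y = r X \<odot> Ide C Y"
  using LR by (auto simp: LR_units_def)

text \<open>Tensoring with \<open>I\<close> on either side is naturally isomorphic to the identity
  through \<open>l\<close> or \<open>r\<close>, hence fully faithful.\<close>

lemma saavedra: "(I, l I) \<in> saavedra_units C"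
  using LR I_obj l_Hom[OF I_obj] l_iso[OF I_obj] natural_iso_identity_imp_fully_faithful
  by (auto simp: saavedra_units_def cancellable_def LR_units_def)

text \<open>The swap axiom at \<open>I\<close> and \<open>X\<close>, with \<open>l I = r I\<close>,
  is the equation characterizing the described arrow. Off the objects both functions are
  \<open>undefined\<close>, so they agree everywhere.\<close>

lemma saavedra_left_eq: "saavedra_left C (I, l I) = l"
proof
  fix X show "saavedra_left C (I, l I) X = l X"
  proof (cases "X \<in> Obj C")
    case True
    then have "l X \<in> Hom C (I \<otimes> X) X \<and> Ide C I \<odot> l X = l I \<odot> Ide C X"
      using l_Hom l_r_swap I_obj l_I_eq_r_I by simp
    then show ?thesis
      using the1_equality[OF saavedra_left_ex1[OF saavedra True]] True
      by (simp add: saavedra_left_def)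
  next
    case False
    then show ?thesis
      using l_ext by (simp add: saavedra_left_def extensional_def)
  qed
qed

text \<open>Here the characterizing equation is the swap axiom at \<open>X\<close> and
  \<open>I\<close>.\<close>

lemma saavedra_right_eq: "saavedra_right C (I, l I) = r"
proof
  fix X show "saavedra_right C (I, l I) X = r X"
  proof (cases "X \<in> Obj C")
    case True
    then have "r X \<in> Hom C (X \<otimes> I) X \<and> r X \<odot> Ide C I = Ide C X \<odot> l I"
      using r_Hom l_r_swap I_obj by simp
    then show ?thesis
      using the1_equality[OF saavedra_right_ex1[OF saavedra True]] True
      by (simp add: saavedra_right_def)
  next
    case False
    then show ?thesis
      using r_ext by (simp add: saavedra_right_def extensional_def)
  qed
qed

end


section \<open>From Saavedra units to LR units\<close>

locale saavedra_unit = semimonoidal_category C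
  for C :: "('o, 'a, 'm) semimonoidal_data_scheme" (structure) +
  fixes I a
  assumes saavedra: "(I, a) \<in> saavedra_units C"
begin

abbreviation "l \<equiv> saavedra_left C (I, a)"
abbreviation "r \<equiv> saavedra_right C (I, a)"

lemma I_obj: "I \<in> Obj C" and a_Hom: "a \<in> Hom C (I \<otimes> I) I" and a_iso: "iso_arrow C a"
  and left_ff: "fully_faithful C C (left_tensor C I)"
  and right_ff: "fully_faithful C C (right_tensor C I)"
  using saavedra by (auto simp: saavedra_units_def cancellable_def)

lemma l_Hom: "X \<in> Obj C \<Longrightarrow> l X \<in> Hom C (I \<otimes> X) X"
  and I_l: "X \<in> Obj C \<Longrightarrow> Ide C I \<odot> l X = a \<odot> Ide C X"
  using theI'[OF saavedra_left_ex1[OF saavedra, of X]] by (auto simp: saavedra_left_def)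

lemma r_Hom: "X \<in> Obj C \<Longrightarrow> r X \<in> Hom C (X \<otimes> I) X"
  and r_I: "X \<in> Obj C \<Longrightarrow> r X \<odot> Ide C I = Ide C X \<odot> a"
  using theI'[OF saavedra_right_ex1[OF saavedra, of X]] by (auto simp: saavedra_right_def)

lemma left_cancel:
  "f \<in> Hom C X Y \<Longrightarrow> g \<in> Hom C X Y \<Longrightarrow> Ide C I \<odot> f = Ide C I \<odot> g \<Longrightarrow> f = g"
  using fully_faithful_imp_eq[OF left_ff] by (simp add: left_tensor_def)

lemma right_cancel:
  "f \<in> Hom C X Y \<Longrightarrow> g \<in> Hom C X Y \<Longrightarrow> f \<odot> Ide C I = g \<odot> Ide C I \<Longrightarrow> f = g"
  using fully_faithful_imp_eq[OF right_ff] by (simp add: right_tensor_def)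

text \<open>The image of \<open>l X\<close> under the fully faithful functor
  \<open>left_tensor C I\<close> is \<open>a \<odot> Ide C X\<close>, an isomorphism, and
  isomorphisms are reflected.\<close>

lemma l_iso:
  assumes "X \<in> Obj C"
  shows "iso_arrow C (l X)"
  using fully_faithful_reflects_iso[OF left_ff l_Hom[OF assms]] I_l[OF assms] assms
    iso_tensor[OF a_iso a_Hom iso_Ide Ide_closed]
  by (simp add: left_tensor_def)

lemma r_iso:
  assumes "X \<in> Obj C"
  shows "iso_arrow C (r X)"
  using fully_faithful_reflects_iso[OF right_ff r_Hom[OF assms]] r_I[OF assms] assms
    iso_tensor[OF iso_Ide Ide_closed a_iso a_Hom]
  by (simp add: right_tensor_def)

text \<open>After tensoring with \<open>I\<close> on the left, both sides become factorizations of
  \<open>a \<odot> f\<close>.\<close>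

lemma l_natural:
  assumes f: "f \<in> Hom C X Y"
  shows "l Y \<cdot> (Ide C I \<odot> f) = f \<cdot> l X"
proof (rule left_cancel)
  have X: "X \<in> Obj C" and Y: "Y \<in> Obj C"
    using Hom_Obj[OF f] by auto
  have If: "Ide C I \<odot> f \<in> Hom C (I \<otimes> X) (I \<otimes> Y)"
    using tensor_arr_closed[OF Ide_closed[OF I_obj] f] .
  show "l Y \<cdot> (Ide C I \<odot> f) \<in> Hom C (I \<otimes> X) Y" "f \<cdot> l X \<in> Hom C (I \<otimes> X) Y"
    using Comp_closed If f l_Hom X Y by blast+
  have "Ide C I \<odot> (l Y \<cdot> (Ide C I \<odot> f)) = (a \<odot> Ide C Y) \<cdot> (Ide C (I \<otimes> I) \<odot> f)"
    using whisker_left[OF I_obj If l_Hom[OF Y]] I_l[OF Y]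
      tensor_arr_assoc[OF Ide_arr[OF I_obj] Ide_arr[OF I_obj] Hom_arr[OF f]]
    by (simp add: Ide_tensor I_obj)
  also have "\<dots> = (Ide C I \<odot> f) \<cdot> (a \<odot> Ide C X)"
    using tensor_eq_right_left[OF a_Hom f] tensor_eq_left_right[OF a_Hom f] by simp
  also have "\<dots> = Ide C I \<odot> (f \<cdot> l X)"
    using whisker_left[OF I_obj l_Hom[OF X] f] I_l[OF X] by simp
  finally show "Ide C I \<odot> (l Y \<cdot> (Ide C I \<odot> f)) = Ide C I \<odot> (f \<cdot> l X)" .
qed

text \<open>Mirror image: tensored with \<open>I\<close> on the right, both sides become
  \<open>f \<odot> a\<close>.\<close>

lemma r_natural:
  assumes f: "f \<in> Hom C X Y"
  shows "r Y \<cdot> (f \<odot> Ide C I) = f \<cdot> r X"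
proof (rule right_cancel)
  have X: "X \<in> Obj C" and Y: "Y \<in> Obj C"
    using Hom_Obj[OF f] by auto
  have fI: "f \<odot> Ide C I \<in> Hom C (X \<otimes> I) (Y \<otimes> I)"
    using tensor_arr_closed[OF f Ide_closed[OF I_obj]] .
  show "r Y \<cdot> (f \<odot> Ide C I) \<in> Hom C (X \<otimes> I) Y" "f \<cdot> r X \<in> Hom C (X \<otimes> I) Y"
    using Comp_closed fI f r_Hom X Y by blast+
  have "(r Y \<cdot> (f \<odot> Ide C I)) \<odot> Ide C I = (Ide C Y \<odot> a) \<cdot> (f \<odot> Ide C (I \<otimes> I))"
    using whisker_right[OF I_obj fI r_Hom[OF Y]] r_I[OF Y]
      tensor_arr_assoc[OF Hom_arr[OF f] Ide_arr[OF I_obj] Ide_arr[OF I_obj]]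
    by (simp add: Ide_tensor I_obj)
  also have "\<dots> = (f \<odot> Ide C I) \<cdot> (Ide C X \<odot> a)"
    using tensor_eq_right_left[OF f a_Hom] tensor_eq_left_right[OF f a_Hom] by simp
  also have "\<dots> = (f \<cdot> r X) \<odot> Ide C I"
    using whisker_right[OF I_obj r_Hom[OF X] f] r_I[OF X] by simp
  finally show "(r Y \<cdot> (f \<odot> Ide C I)) \<odot> Ide C I = (f \<cdot> r X) \<odot> Ide C I" .
qed

text \<open>By strict associativity, tensoring either side with \<open>I\<close> on the left gives
  \<open>a\<close> followed by the identities of \<open>X\<close> and \<open>Y\<close>.\<close>

lemma l_tensor:
  assumes X: "X \<in> Obj C" and Y: "Y \<in> Obj C"
  shows "l (X \<otimes> Y) = l X \<odot> Ide C Y"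
proof (rule left_cancel)
  show "l (X \<otimes> Y) \<in> Hom C (I \<otimes> (X \<otimes> Y)) (X \<otimes> Y)"
    by (intro l_Hom tensor_obj_closed X Y)
  show "l X \<odot> Ide C Y \<in> Hom C (I \<otimes> (X \<otimes> Y)) (X \<otimes> Y)"
    using tensor_arr_closed[OF l_Hom[OF X] Ide_closed[OF Y]] by (simp add: tensor_obj_assoc I_obj X Y)
  have "Ide C I \<odot> (l X \<odot> Ide C Y) = (a \<odot> Ide C X) \<odot> Ide C Y"
    using tensor_arr_assoc[OF Ide_arr[OF I_obj] Hom_arr[OF l_Hom[OF X]] Ide_arr[OF Y]] I_l[OF X]
    by simp
  also have "\<dots> = a \<odot> Ide C (X \<otimes> Y)"
    using tensor_arr_assoc[OF Hom_arr[OF a_Hom] Ide_arr[OF X] Ide_arr[OF Y]] Ide_tensor X Y by simp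
  finally show "Ide C I \<odot> l (X \<otimes> Y) = Ide C I \<odot> (l X \<odot> Ide C Y)"
    using I_l tensor_obj_closed X Y by simp
qed

lemma r_tensor:
  assumes X: "X \<in> Obj C" and Y: "Y \<in> Obj C"
  shows "r (X \<otimes> Y) = Ide C X \<odot> r Y"
proof (rule right_cancel)
  show "r (X \<otimes> Y) \<in> Hom C ((X \<otimes> Y) \<otimes> I) (X \<otimes> Y)"
    by (intro r_Hom tensor_obj_closed X Y)
  show "Ide C X \<odot> r Y \<in> Hom C ((X \<otimes> Y) \<otimes> I) (X \<otimes> Y)"
    using tensor_arr_closed[OF Ide_closed[OF X] r_Hom[OF Y]] by (simp add: tensor_obj_assoc I_obj X Y)
  have "(Ide C X \<odot> r Y) \<odot> Ide C I = Ide C X \<odot> (Ide C Y \<odot> a)"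
    using tensor_arr_assoc[OF Ide_arr[OF X] Hom_arr[OF r_Hom[OF Y]] Ide_arr[OF I_obj]] r_I[OF Y]
    by simp
  also have "\<dots> = Ide C (X \<otimes> Y) \<odot> a"
    using tensor_arr_assoc[OF Ide_arr[OF X] Ide_arr[OF Y] Hom_arr[OF a_Hom]] Ide_tensor X Y by simp
  finally show "r (X \<otimes> Y) \<odot> Ide C I = (Ide C X \<odot> r Y) \<odot> Ide C I"
    using r_I tensor_obj_closed X Y by simp
qed

lemma l_I: "l I = a"
proof (rule right_cancel)
  show "l I \<in> Hom C (I \<otimes> I) I" "a \<in> Hom C (I \<otimes> I) I"
    using l_Hom I_obj a_Hom by auto
  have II: "I \<otimes> I \<in> Obj C"
    using I_obj tensor_obj_closed by blast
  \<comment> \<open>Naturality of \<open>l\<close> at the arrow \<open>l I\<close> makes the two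
    sides agree after composing with \<open>l I\<close>, which is monic.\<close>
  have "l (I \<otimes> I) = Ide C I \<odot> l I"
    using iso_monic[OF l_iso l_Hom l_Hom[OF II] tensor_arr_closed[OF Ide_closed l_Hom]] I_obj
      l_natural[OF l_Hom[OF I_obj]] by simp
  \<comment> \<open>The left side above is \<open>l I \<odot> Ide C I\<close> by
    \<open>l_tensor\<close>, the right side is \<open>a \<odot> Ide C I\<close> by
    \<open>I_l\<close>.\<close>
  then show "l I \<odot> Ide C I = a \<odot> Ide C I"
    using l_tensor I_l I_obj by simp
qed

lemma r_I_eq: "r I = a"
proof (rule left_cancel)
  show "r I \<in> Hom C (I \<otimes> I) I" "a \<in> Hom C (I \<otimes> I) I"
    using r_Hom I_obj a_Hom by auto
  have II: "I \<otimes> I \<in> Obj C"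
    using I_obj tensor_obj_closed by blast
  have "r (I \<otimes> I) = r I \<odot> Ide C I"
    using iso_monic[OF r_iso r_Hom r_Hom[OF II] tensor_arr_closed[OF r_Hom Ide_closed]] I_obj
      r_natural[OF r_Hom[OF I_obj]] by simp
  then show "Ide C I \<odot> r I = Ide C I \<odot> a"
    using r_tensor r_I I_obj by simp
qed

lemma l_r_swap:
  assumes X: "X \<in> Obj C" and Y: "Y \<in> Obj C"
  shows "Ide C X \<odot> l Y = r X \<odot> Ide C Y"
proof -
  have IY: "I \<otimes> Y \<in> Obj C" and XI: "X \<otimes> I \<in> Obj C"
    using tensor_obj_closed I_obj X Y by auto
  \<comment> \<open>This isomorphism also equals \<open>Ide C (X \<otimes> I) \<odot> l Y\<close>,
    since both are \<open>a\<close> flanked by the identities of \<open>X\<close> and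
    \<open>Y\<close>. It is therefore the first factor in both factorizations of
    \<open>r X \<odot> l Y\<close> and can be cancelled.\<close>
  let ?e = "r X \<odot> Ide C (I \<otimes> Y)"
  have e: "?e \<in> Hom C ((X \<otimes> I) \<otimes> (I \<otimes> Y)) (X \<otimes> (I \<otimes> Y))"
    using tensor_arr_closed[OF r_Hom[OF X] Ide_closed[OF IY]] .
  have "?e = (r X \<odot> Ide C I) \<odot> Ide C Y"
    using tensor_arr_assoc[OF Hom_arr[OF r_Hom[OF X]] Ide_arr[OF I_obj] Ide_arr[OF Y]]
      Ide_tensor I_obj Y by simp
  also have "\<dots> = Ide C X \<odot> (Ide C I \<odot> l Y)"
    using tensor_arr_assoc[OF Ide_arr[OF X] Hom_arr[OF a_Hom] Ide_arr[OF Y]] r_I[OF X] I_l[OF Y]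
    by simp
  also have "\<dots> = Ide C (X \<otimes> I) \<odot> l Y"
    using tensor_arr_assoc[OF Ide_arr[OF X] Ide_arr[OF I_obj] Hom_arr[OF l_Hom[OF Y]]]
      Ide_tensor I_obj X by simp
  finally have "(Ide C X \<odot> l Y) \<cdot> ?e = (r X \<odot> Ide C Y) \<cdot> ?e"
    using tensor_eq_left_right[OF r_Hom[OF X] l_Hom[OF Y]]
      tensor_eq_right_left[OF r_Hom[OF X] l_Hom[OF Y]] by simp
  moreover have "iso_arrow C ?e"
    using iso_tensor[OF r_iso[OF X] r_Hom[OF X] iso_Ide[OF IY] Ide_closed[OF IY]] .
  moreover have "Ide C X \<odot> l Y \<in> Hom C (X \<otimes> (I \<otimes> Y)) (X \<otimes> Y)"
    using tensor_arr_closed[OF Ide_closed[OF X] l_Hom[OF Y]] .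
  moreover have "r X \<odot> Ide C Y \<in> Hom C (X \<otimes> (I \<otimes> Y)) (X \<otimes> Y)"
    using tensor_arr_closed[OF r_Hom[OF X] Ide_closed[OF Y]] by (simp add: tensor_obj_assoc I_obj X Y)
  ultimately show ?thesis
    using iso_epic[OF _ e] by blast
qed

lemma LR: "(I, l, r) \<in> LR_units C"
proof -
  have "l \<in> extensional (Obj C)" "r \<in> extensional (Obj C)"
    by (simp_all add: saavedra_left_def saavedra_right_def)
  then have "natural_iso C C (left_tensor C I) identity_functor l"
    and "natural_iso C C (right_tensor C I) identity_functor r"
    unfolding natural_iso_def
    using left_tensor_functor right_tensor_functor identity_functor I_obj
      l_Hom l_iso l_natural r_Hom r_iso r_natural
    by (auto simp: left_tensor_def right_tensor_def identity_functor_def)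
  then show ?thesis
    using I_obj l_I r_I_eq l_tensor r_tensor l_r_swap by (simp add: LR_units_def)
qed

end


section \<open>Arrows of units\<close>

locale lr_unit_pair = semimonoidal_category C +
  U: lr_unit C I l r + V: lr_unit C J m s
  for C :: "('o, 'a, 'm) semimonoidal_data_scheme" (structure) and I l r J m s
begin

section \<open>LR compatibility versus Saavedra morphisms\<close>

lemma LR_compatible_iff:
  "LR_compatible C (I, l, r) (J, m, s) p \<longleftrightarrow>
     (\<forall>X \<in> Obj C. m X \<cdot> (p \<odot> Ide C X) = l X \<and> s X \<cdot> (Ide C X \<odot> p) = r X)"
  by (simp add: LR_compatible_def)

context
  fixes p assumes p: "p \<in> Hom C I J"
begin

lemma p_left: "X \<in> Obj C \<Longrightarrow> p \<odot> Ide C X \<in> Hom C (I \<otimes> X) (J \<otimes> X)"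
  and p_right: "X \<in> Obj C \<Longrightarrow> Ide C X \<odot> p \<in> Hom C (X \<otimes> I) (X \<otimes> J)"
  using tensor_arr_closed[OF p Ide_closed] tensor_arr_closed[OF Ide_closed p] by auto

text \<open>Factoring \<open>p \<odot> f\<close> through \<open>Ide C I \<odot> f\<close> reduces
  this to compatibility at \<open>Y\<close> and naturality of \<open>l\<close>. It serves as a
  conjugation relation and, at \<open>f = p\<close>, as the homomorphism law.\<close>

lemma compatible_tensor_left:
  assumes "LR_compatible C (I, l, r) (J, m, s) p" and f: "f \<in> Hom C X Y"
  shows "m Y \<cdot> (p \<odot> f) = f \<cdot> l X"
proof -
  have Y: "Y \<in> Obj C"
    using Hom_Obj[OF f] by simp
  have "m Y \<cdot> (p \<odot> f) = (m Y \<cdot> (p \<odot> Ide C Y)) \<cdot> (Ide C I \<odot> f)"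
    using tensor_eq_right_left[OF p f] Comp_assoc[OF tensor_arr_closed[OF Ide_closed f] p_left V.l_Hom]
      U.I_obj Y by simp
  also have "\<dots> = f \<cdot> l X"
    using assms Y U.l_natural[OF f] by (simp add: LR_compatible_iff)
  finally show ?thesis .
qed

lemma compatible_tensor_right:
  assumes "LR_compatible C (I, l, r) (J, m, s) p" and f: "f \<in> Hom C X Y"
  shows "s Y \<cdot> (f \<odot> p) = f \<cdot> r X"
proof -
  have Y: "Y \<in> Obj C"
    using Hom_Obj[OF f] by simp
  have "s Y \<cdot> (f \<odot> p) = (s Y \<cdot> (Ide C Y \<odot> p)) \<cdot> (f \<odot> Ide C I)"
    using tensor_eq_left_right[OF f p] Comp_assoc[OF tensor_arr_closed[OF f Ide_closed] p_right V.r_Hom]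
      U.I_obj Y by simp
  also have "\<dots> = f \<cdot> r X"
    using assms Y U.r_natural[OF f] by (simp add: LR_compatible_iff)
  finally show ?thesis .
qed

lemma compatible_imp_saavedra:
  assumes "LR_compatible C (I, l, r) (J, m, s) p"
  shows "saavedra_morphism C (I, l I) (J, m J) p"
proof -
  have "bij_betw (\<lambda>f. p \<odot> f) (Hom C X Y) (Hom C (I \<otimes> X) (J \<otimes> Y))"
    if "X \<in> Obj C" "Y \<in> Obj C" for X Y
    using that
    by (intro bij_betw_Hom_conjugation[of "l X" _ _ "m Y"] U.l_Hom U.l_iso V.l_Hom V.l_iso
          tensor_arr_closed[OF p] compatible_tensor_left[OF assms])
  moreover have "bij_betw (\<lambda>f. f \<odot> p) (Hom C X Y) (Hom C (X \<otimes> I) (Y \<otimes> J))"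
    if "X \<in> Obj C" "Y \<in> Obj C" for X Y
    using that
    by (intro bij_betw_Hom_conjugation[of "r X" _ _ "s Y"] U.r_Hom U.r_iso V.r_Hom V.r_iso
          tensor_arr_closed[OF _ p] compatible_tensor_right[OF assms])
  ultimately show ?thesis
    using p compatible_tensor_left[OF assms p]
    by (simp add: saavedra_morphism_def tensor_cancellable_def left_tensor_cancellable_def
          right_tensor_cancellable_def)
qed

text \<open>Tensoring with \<open>p\<close> on the left is injective, so the two arrows may be
  compared after it. The swap axiom turns \<open>Ide C J \<odot> m X\<close> into
  \<open>m J \<odot> Ide C X\<close>, where the homomorphism law applies; the swap axiom for
  \<open>I\<close> then leads back to \<open>p \<odot> l X\<close>.\<close>

lemma saavedra_imp_compatible_left:
  assumes S: "saavedra_morphism C (I, l I) (J, m J) p" and X: "X \<in> Obj C"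
  shows "m X \<cdot> (p \<odot> Ide C X) = l X"
proof -
  have hom: "p \<cdot> l I = m J \<cdot> (p \<odot> p)"
    using S by (simp add: saavedra_morphism_def)
  have pX: "p \<odot> Ide C X \<in> Hom C (I \<otimes> X) (J \<otimes> X)"
    using p_left X by simp
  have IJ: "Ide C J \<cdot> p = p" "p \<cdot> Ide C I = p"
    using Ide_left Ide_right p by auto
  have pp: "p \<odot> p \<in> Hom C (I \<otimes> I) (J \<otimes> J)"
    using tensor_arr_closed p by blast
  \<comment> \<open>The outer \<open>p\<close> is read as \<open>Ide C J \<cdot> p\<close>, so that
    interchange applies.\<close>
  have "p \<odot> (m X \<cdot> (p \<odot> Ide C X)) = (Ide C J \<odot> m X) \<cdot> (p \<odot> (p \<odot> Ide C X))"
    using interchange[OF p Ide_closed[OF V.I_obj] pX V.l_Hom[OF X]] IJ by simp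
  also have "\<dots> = (m J \<odot> Ide C X) \<cdot> ((p \<odot> p) \<odot> Ide C X)"
    using V.l_r_swap V.l_I_eq_r_I V.I_obj X tensor_arr_assoc[OF Hom_arr[OF p] Hom_arr[OF p] Ide_arr[OF X]]
    by simp
  also have "\<dots> = (p \<cdot> l I) \<odot> Ide C X"
    using whisker_right[OF X pp V.l_Hom[OF V.I_obj]] hom by simp
  also have "\<dots> = (p \<odot> Ide C X) \<cdot> (Ide C I \<odot> l X)"
    using whisker_right[OF X U.l_Hom[OF U.I_obj] p] U.l_r_swap U.l_I_eq_r_I U.I_obj X by simp
  also have "\<dots> = p \<odot> l X"
    using tensor_eq_right_left[OF p U.l_Hom[OF X]] by simp
  finally have eq: "p \<odot> (m X \<cdot> (p \<odot> Ide C X)) = p \<odot> l X" .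
  have "inj_on (\<lambda>f. p \<odot> f) (Hom C (I \<otimes> X) X)"
    using S X tensor_obj_closed[OF U.I_obj X]
    by (simp add: saavedra_morphism_def tensor_cancellable_def left_tensor_cancellable_def bij_betw_def)
  then show ?thesis
    using eq Comp_closed[OF pX V.l_Hom[OF X]] U.l_Hom[OF X] by (simp add: inj_on_def)
qed

text \<open>The mirror argument, with right tensor cancellability; the homomorphism law is now used
  under \<open>Ide C X \<odot> _\<close>.\<close>

lemma saavedra_imp_compatible_right:
  assumes S: "saavedra_morphism C (I, l I) (J, m J) p" and X: "X \<in> Obj C"
  shows "s X \<cdot> (Ide C X \<odot> p) = r X"
proof -
  have hom: "p \<cdot> l I = m J \<cdot> (p \<odot> p)"
    using S by (simp add: saavedra_morphism_def)
  have Xp: "Ide C X \<odot> p \<in> Hom C (X \<otimes> I) (X \<otimes> J)"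
    using p_right X by simp
  have IJ: "Ide C J \<cdot> p = p" "p \<cdot> Ide C I = p"
    using Ide_left Ide_right p by auto
  have pp: "p \<odot> p \<in> Hom C (I \<otimes> I) (J \<otimes> J)"
    using tensor_arr_closed p by blast
  have "(s X \<cdot> (Ide C X \<odot> p)) \<odot> p = (s X \<odot> Ide C J) \<cdot> ((Ide C X \<odot> p) \<odot> p)"
    using interchange[OF Xp V.r_Hom[OF X] p Ide_closed[OF V.I_obj]] IJ by simp
  also have "\<dots> = (Ide C X \<odot> m J) \<cdot> (Ide C X \<odot> (p \<odot> p))"
    using V.l_r_swap V.I_obj X tensor_arr_assoc[OF Ide_arr[OF X] Hom_arr[OF p] Hom_arr[OF p]]
    by simp
  also have "\<dots> = Ide C X \<odot> (p \<cdot> l I)"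
    using whisker_left[OF X pp V.l_Hom[OF V.I_obj]] hom by simp
  also have "\<dots> = (Ide C X \<odot> p) \<cdot> (r X \<odot> Ide C I)"
    using whisker_left[OF X U.l_Hom[OF U.I_obj] p] U.l_r_swap U.I_obj X by simp
  also have "\<dots> = r X \<odot> p"
    using tensor_eq_left_right[OF U.r_Hom[OF X] p] by simp
  finally have eq: "(s X \<cdot> (Ide C X \<odot> p)) \<odot> p = r X \<odot> p" .
  have "inj_on (\<lambda>f. f \<odot> p) (Hom C (X \<otimes> I) X)"
    using S X tensor_obj_closed[OF X U.I_obj]
    by (simp add: saavedra_morphism_def tensor_cancellable_def right_tensor_cancellable_def bij_betw_def)
  then show ?thesis
    using eq Comp_closed[OF Xp V.r_Hom[OF X]] U.r_Hom[OF X] by (simp add: inj_on_def)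
qed

lemma saavedra_morphism_iff_compatible:
  "saavedra_morphism C (I, l I) (J, m J) p \<longleftrightarrow> LR_compatible C (I, l, r) (J, m, s) p"
  using compatible_imp_saavedra saavedra_imp_compatible_left saavedra_imp_compatible_right
  by (auto simp: LR_compatible_iff)

end

section \<open>Existence and uniqueness of an arrow between two LR units\<close>

lemma compatible_unique:
  assumes p: "p \<in> Hom C I J" "LR_compatible C (I, l, r) (J, m, s) p"
    and q: "q \<in> Hom C I J" "LR_compatible C (I, l, r) (J, m, s) q"
  shows "p = q"
proof -
  \<comment> \<open>Compatibility with \<open>s\<close> at \<open>I\<close> says that both sides
    give \<open>r I\<close> after \<open>s I\<close>, which is monic. Naturality of \<open>l\<close>
    then removes the tensor factor \<open>Ide C I\<close>.\<close>
  have "Ide C I \<odot> p = Ide C I \<odot> q"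
    using iso_monic[OF V.r_iso V.r_Hom p_right[OF p(1)] p_right[OF q(1)]] p(2) q(2) U.I_obj
    by (simp add: LR_compatible_iff)
  then have "p \<cdot> l I = q \<cdot> l I"
    using U.l_natural[OF p(1)] U.l_natural[OF q(1)] by simp
  then show ?thesis
    using iso_epic[OF U.l_iso U.l_Hom p(1) q(1)] U.I_obj by simp
qed

lemma compatible_exists: "\<exists>p \<in> Hom C I J. LR_compatible C (I, l, r) (J, m, s) p"
proof -
  note I = U.I_obj and J = V.I_obj
  \<comment> \<open>The arrow is forced: naturality of \<open>s\<close> gives
    \<open>p \<cdot> s I = s J \<cdot> (p \<odot> Ide C J)\<close>, and with
    \<open>s J = m J\<close> compatibility makes this \<open>l J\<close>. So \<open>p\<close> has to
    be \<open>l J\<close> after the inverse \<open>k\<close> of \<open>s I\<close>.\<close>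
  obtain k where k: "k \<in> Hom C I (I \<otimes> J)" "k \<cdot> s I = Ide C (I \<otimes> J)" "s I \<cdot> k = Ide C I"
    by (rule iso_arrowE[OF V.r_iso[OF I] V.r_Hom[OF I]])
  define p where "p = l J \<cdot> k"
  have p: "p \<in> Hom C I J"
    unfolding p_def using k(1) U.l_Hom[OF J] by (rule Comp_closed)
  have p_s: "p \<cdot> s I = l J"
    unfolding p_def
    using Comp_assoc[OF V.r_Hom[OF I] k(1) U.l_Hom[OF J]] k(2) Ide_right[OF U.l_Hom[OF J]] by simp
  \<comment> \<open>Precomposing with the isomorphism \<open>Ide C I \<odot> m X\<close>, which is
    \<open>s I \<odot> Ide C X\<close> by the swap axiom, brings \<open>p\<close> next to
    \<open>s I\<close>, so that \<open>p_s\<close> applies; naturality of \<open>l\<close> at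
    \<open>m X\<close> finishes.\<close>
  have "m X \<cdot> (p \<odot> Ide C X) = l X" if X: "X \<in> Obj C" for X
  proof (rule iso_epic)
    have JX: "J \<otimes> X \<in> Obj C"
      using J X tensor_obj_closed by blast
    show e: "Ide C I \<odot> m X \<in> Hom C (I \<otimes> (J \<otimes> X)) (I \<otimes> X)"
      using tensor_arr_closed[OF Ide_closed[OF I] V.l_Hom[OF X]] .
    show "iso_arrow C (Ide C I \<odot> m X)"
      using iso_tensor[OF iso_Ide[OF I] Ide_closed[OF I] V.l_iso[OF X] V.l_Hom[OF X]] .
    show "m X \<cdot> (p \<odot> Ide C X) \<in> Hom C (I \<otimes> X) X" "l X \<in> Hom C (I \<otimes> X) X"
      using Comp_closed[OF p_left[OF p X] V.l_Hom[OF X]] U.l_Hom[OF X] by auto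
    have "(m X \<cdot> (p \<odot> Ide C X)) \<cdot> (Ide C I \<odot> m X) = m X \<cdot> ((p \<odot> Ide C X) \<cdot> (s I \<odot> Ide C X))"
      using Comp_assoc[OF e p_left[OF p X] V.l_Hom[OF X]] V.l_r_swap[OF I X] by simp
    also have "\<dots> = m X \<cdot> l (J \<otimes> X)"
      using whisker_right[OF X V.r_Hom[OF I] p] p_s U.l_tensor[OF J X] by simp
    also have "\<dots> = l X \<cdot> (Ide C I \<odot> m X)"
      using U.l_natural[OF V.l_Hom[OF X]] by simp
    finally show "(m X \<cdot> (p \<odot> Ide C X)) \<cdot> (Ide C I \<odot> m X) = l X \<cdot> (Ide C I \<odot> m X)" .
  qed
  \<comment> \<open>Here the isomorphism is \<open>Ide C X \<odot> s I\<close>: \<open>p_s\<close>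
    and the swap axiom produce \<open>r X \<odot> Ide C J\<close>, and naturality of
    \<open>s\<close> at \<open>r X\<close> finishes.\<close>
  moreover have "s X \<cdot> (Ide C X \<odot> p) = r X" if X: "X \<in> Obj C" for X
  proof (rule iso_epic)
    show e: "Ide C X \<odot> s I \<in> Hom C (X \<otimes> (I \<otimes> J)) (X \<otimes> I)"
      using tensor_arr_closed[OF Ide_closed[OF X] V.r_Hom[OF I]] .
    show "iso_arrow C (Ide C X \<odot> s I)"
      using iso_tensor[OF iso_Ide[OF X] Ide_closed[OF X] V.r_iso[OF I] V.r_Hom[OF I]] .
    show "s X \<cdot> (Ide C X \<odot> p) \<in> Hom C (X \<otimes> I) X" "r X \<in> Hom C (X \<otimes> I) X"
      using Comp_closed[OF p_right[OF p X] V.r_Hom[OF X]] U.r_Hom[OF X] by auto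
    have "(s X \<cdot> (Ide C X \<odot> p)) \<cdot> (Ide C X \<odot> s I) = s X \<cdot> ((Ide C X \<odot> p) \<cdot> (Ide C X \<odot> s I))"
      using Comp_assoc[OF e p_right[OF p X] V.r_Hom[OF X]] .
    also have "\<dots> = s X \<cdot> (r X \<odot> Ide C J)"
      using whisker_left[OF X V.r_Hom[OF I] p] p_s U.l_r_swap[OF X J] by simp
    also have "\<dots> = r X \<cdot> (Ide C X \<odot> s I)"
      using V.r_natural[OF U.r_Hom[OF X]] V.r_tensor[OF X I] by simp
    finally show "(s X \<cdot> (Ide C X \<odot> p)) \<cdot> (Ide C X \<odot> s I) = r X \<cdot> (Ide C X \<odot> s I)" .
  qed
  ultimately show ?thesis
    using p by (auto simp: LR_compatible_iff)
qed

end


section \<open>The isomorphism of categories\<close>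

context semimonoidal_category
begin

lemma lr_unitI: "(I, l, r) \<in> LR_units C \<Longrightarrow> lr_unit C I l r"
  by (simp add: lr_unit_def lr_unit_axioms_def semimonoidal_category_axioms)

lemma lr_unit_pairI:
  "(I, l, r) \<in> LR_units C \<Longrightarrow> (J, m, s) \<in> LR_units C \<Longrightarrow> lr_unit_pair C I l r J m s"
  by (simp add: lr_unit_pair_def lr_unitI semimonoidal_category_axioms)

lemma LR_to_saavedra_obj_closed: "x \<in> LR_units C \<Longrightarrow> LR_to_saavedra_obj x \<in> saavedra_units C"
  by (cases x) (auto simp: LR_to_saavedra_obj_def intro: lr_unit.saavedra lr_unitI)

lemma saavedra_to_LR_obj_closed: "t \<in> saavedra_units C \<Longrightarrow> saavedra_to_LR_obj C t \<in> LR_units C"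
  by (cases t)
     (simp add: saavedra_to_LR_obj_def saavedra_unit.LR saavedra_unit_def
        saavedra_unit_axioms_def semimonoidal_category_axioms)

lemma saavedra_to_LR_to_saavedra:
  "t \<in> saavedra_units C \<Longrightarrow> LR_to_saavedra_obj (saavedra_to_LR_obj C t) = t"
  by (cases t)
     (simp add: saavedra_to_LR_obj_def LR_to_saavedra_obj_def saavedra_unit.l_I saavedra_unit_def
        saavedra_unit_axioms_def semimonoidal_category_axioms)

lemma LR_to_saavedra_to_LR:
  "x \<in> LR_units C \<Longrightarrow> saavedra_to_LR_obj C (LR_to_saavedra_obj x) = x"
  by (cases x)
     (auto simp: saavedra_to_LR_obj_def LR_to_saavedra_obj_def
        intro: lr_unit.saavedra_left_eq lr_unit.saavedra_right_eq lr_unitI)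

lemma fst_LR_to_saavedra_obj: "fst (LR_to_saavedra_obj x) = fst x"
  by (simp add: LR_to_saavedra_obj_def split: prod.split)

lemma fst_saavedra_to_LR_obj: "fst (saavedra_to_LR_obj C t) = fst t"
  by (simp add: saavedra_to_LR_obj_def)

lemma saavedra_morphism_iff_LR_compatible:
  assumes "x \<in> LR_units C" "y \<in> LR_units C" "p \<in> Hom C (fst x) (fst y)"
  shows "saavedra_morphism C (LR_to_saavedra_obj x) (LR_to_saavedra_obj y) p \<longleftrightarrow> LR_compatible C x y p"
  using assms
  by (cases x; cases y)
     (simp add: LR_to_saavedra_obj_def lr_unit_pair.saavedra_morphism_iff_compatible lr_unit_pairI)

lemma LR_compatible_Ide:
  assumes "x \<in> LR_units C"
  shows "LR_compatible C x x (Ide C (fst x))"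
proof -
  obtain I l r where x: "x = (I, l, r)"
    by (cases x)
  interpret lr_unit C I l r
    using assms lr_unitI x by simp
  show ?thesis
    using Ide_right[OF l_Hom] Ide_right[OF r_Hom]
    by (simp add: x LR_compatible_def Ide_tensor I_obj)
qed

lemma LR_compatible_Comp:
  assumes LR: "x \<in> LR_units C" "y \<in> LR_units C" "z \<in> LR_units C"
    and p: "p \<in> Hom C (fst x) (fst y)" "LR_compatible C x y p"
    and q: "q \<in> Hom C (fst y) (fst z)" "LR_compatible C y z q"
  shows "LR_compatible C x z (q \<cdot> p)"
proof -
  obtain I l r J m s K n t where xyz: "x = (I, l, r)" "y = (J, m, s)" "z = (K, n, t)"
    by (cases x, cases y, cases z)
  interpret xy: lr_unit_pair C I l r J m s
    using LR lr_unit_pairI xyz by simp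
  interpret yz: lr_unit_pair C J m s K n t
    using LR lr_unit_pairI xyz by simp
  have p': "p \<in> Hom C I J" and q': "q \<in> Hom C J K"
    using p q xyz by auto
  have "n X \<cdot> ((q \<cdot> p) \<odot> Ide C X) = l X \<and> t X \<cdot> (Ide C X \<odot> (q \<cdot> p)) = r X"
    if X: "X \<in> Obj C" for X
  proof
    have "n X \<cdot> ((q \<cdot> p) \<odot> Ide C X) = (n X \<cdot> (q \<odot> Ide C X)) \<cdot> (p \<odot> Ide C X)"
      using whisker_right[OF X p' q']
        Comp_assoc[OF xy.p_left[OF p' X] yz.p_left[OF q' X] yz.V.l_Hom[OF X]] by simp
    then show "n X \<cdot> ((q \<cdot> p) \<odot> Ide C X) = l X"
      using p(2) q(2) X xyz by (simp add: LR_compatible_def)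
    have "t X \<cdot> (Ide C X \<odot> (q \<cdot> p)) = (t X \<cdot> (Ide C X \<odot> q)) \<cdot> (Ide C X \<odot> p)"
      using whisker_left[OF X p' q']
        Comp_assoc[OF xy.p_right[OF p' X] yz.p_right[OF q' X] yz.V.r_Hom[OF X]] by simp
    then show "t X \<cdot> (Ide C X \<odot> (q \<cdot> p)) = r X"
      using p(2) q(2) X xyz by (simp add: LR_compatible_def)
  qed
  then show ?thesis
    by (simp add: LR_compatible_def xyz)
qed

section \<open>The two categories of units and their isomorphism\<close>

lemma category_LR_category: "category (LR_category C)"
  unfolding LR_category_def
proof (rule category_structured_category)
  show "fst x \<in> Obj C" if "x \<in> LR_units C" for x
    using that by (auto simp: LR_units_def)
qed (rule LR_compatible_Ide LR_compatible_Comp; assumption)+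

lemma saavedra_morphism_iff_LR_compatible':
  assumes "x \<in> saavedra_units C" "y \<in> saavedra_units C" "p \<in> Hom C (fst x) (fst y)"
  shows "saavedra_morphism C x y p \<longleftrightarrow>
           LR_compatible C (saavedra_to_LR_obj C x) (saavedra_to_LR_obj C y) p"
  using saavedra_morphism_iff_LR_compatible[of "saavedra_to_LR_obj C x" "saavedra_to_LR_obj C y" p]
    assms saavedra_to_LR_obj_closed saavedra_to_LR_to_saavedra
  by (simp add: fst_saavedra_to_LR_obj)

text \<open>Identities and composites are checked on the associated LR units, where closure follows
  from the compatibility equations; tensor cancellability of a composite then comes from the
  equivalence of the two notions.\<close>

lemma category_saavedra_category: "category (saavedra_category C)"
  unfolding saavedra_category_def
proof (rule category_structured_category)
  fix x assume x: "x \<in> saavedra_units C"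
  then show fx: "fst x \<in> Obj C"
    by (auto simp: saavedra_units_def cancellable_def)
  show "saavedra_morphism C x x (Ide C (fst x))"
    using LR_compatible_Ide[OF saavedra_to_LR_obj_closed[OF x]] Ide_closed[OF fx]
    by (simp add: saavedra_morphism_iff_LR_compatible' x fst_saavedra_to_LR_obj)
next
  fix x y z f g
  assume xyz: "x \<in> saavedra_units C" "y \<in> saavedra_units C" "z \<in> saavedra_units C"
    and f: "f \<in> Hom C (fst x) (fst y)" and g: "g \<in> Hom C (fst y) (fst z)"
    and "saavedra_morphism C x y f" "saavedra_morphism C y z g"
  then show "saavedra_morphism C x z (g \<cdot> f)"
    using LR_compatible_Comp[of "saavedra_to_LR_obj C x" "saavedra_to_LR_obj C y"
        "saavedra_to_LR_obj C z" f g]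
    by (simp add: saavedra_morphism_iff_LR_compatible' Comp_closed[OF f g]
          saavedra_to_LR_obj_closed fst_saavedra_to_LR_obj)
qed

text \<open>Underlying arrows are left unchanged in both directions, so the inverse laws on arrows
  reduce to those on objects.\<close>

lemma inverse_functors_LR_saavedra:
  "inverse_functors (LR_category C) (saavedra_category C) LR_to_saavedra (saavedra_to_LR C)"
proof -
  have "cat_functor (LR_category C) (saavedra_category C) LR_to_saavedra"
    unfolding LR_category_def saavedra_category_def LR_to_saavedra_def
    by (rule cat_functor_structured_category
          [OF category_LR_category[unfolded LR_category_def]
              category_saavedra_category[unfolded saavedra_category_def]])
       (simp_all add: LR_to_saavedra_obj_closed fst_LR_to_saavedra_obj
          saavedra_morphism_iff_LR_compatible)
  moreover have "cat_functor (saavedra_category C) (LR_category C) (saavedra_to_LR C)"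
    unfolding LR_category_def saavedra_category_def saavedra_to_LR_def
    by (rule cat_functor_structured_category
          [OF category_saavedra_category[unfolded saavedra_category_def]
              category_LR_category[unfolded LR_category_def]])
       (simp_all add: saavedra_to_LR_obj_closed fst_saavedra_to_LR_obj
          saavedra_morphism_iff_LR_compatible')
  ultimately show ?thesis
    by (auto simp: inverse_functors_def LR_category_def saavedra_category_def structured_category_def
          LR_to_saavedra_def saavedra_to_LR_def LR_to_saavedra_to_LR saavedra_to_LR_to_saavedra)
qed

text \<open>Arrows between two Saavedra units are the compatible arrows between their LR units, of
  which there is exactly one.\<close>

lemma contractible_saavedra_category:
  assumes "Obj (saavedra_category C) \<noteq> {}"
  shows "contractible (saavedra_category C)"
proof -
  have "\<exists>!f. f \<in> Hom (saavedra_category C) x y"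
    if x: "x \<in> saavedra_units C" and y: "y \<in> saavedra_units C" for x y
  proof -
    obtain I l r J m s
      where xy: "saavedra_to_LR_obj C x = (I, l, r)" "saavedra_to_LR_obj C y = (J, m, s)"
      by (metis prod_cases3)
    interpret lr_unit_pair C I l r J m s
      using saavedra_to_LR_obj_closed x y xy lr_unit_pairI by metis
    have IJ: "fst x = I" "fst y = J"
      using fst_saavedra_to_LR_obj xy by (metis fst_conv)+
    have "\<exists>!p. p \<in> Hom C (fst x) (fst y) \<and> saavedra_morphism C x y p"
      using compatible_exists compatible_unique saavedra_morphism_iff_LR_compatible'[OF x y]
      unfolding IJ xy by blast
    then show ?thesis
      unfolding saavedra_category_def Hom_structured_category using x y by blast
  qed
  then show ?thesis
    using assms category_saavedra_category
    by (simp add: contractible_def saavedra_category_def structured_category_def)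
qed

end

theorem proposition2p19:
  fixes C :: "('o, 'a) semimonoidal_data"
  assumes "semimonoidal_category C"
  shows "inverse_functors (LR_category C) (saavedra_category C) LR_to_saavedra (saavedra_to_LR C) \<and>
         (Obj (saavedra_category C) \<noteq> {} \<longrightarrow> contractible (saavedra_category C))"
  using semimonoidal_category.inverse_functors_LR_saavedra[OF assms]
    semimonoidal_category.contractible_saavedra_category[OF assms]
  by blast

end
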